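(* Let $(X,\tau)$ be a complete metrizable locally solid vector lattice. If $X$ has a countable topological orthogonal system, then the $u\tau$-topology on $X$ is metrizable.
   Context: A locally solid vector lattice $(X,\tau)$ is a (real) vector lattice $X$ with a Hausdorff linear topology $\tau$ that has a base at zero consisting of solid sets (a set $A$ is solid if $|x|\le|y|$ and $y\in A$ imply $x\in A$). $X_+$ is the positive cone. The $u\tau$-topology (unbounded $\tau$-topology) is the locally solid topology on $X$ having as a neighborhood base at zero the sets $U_{V,w}=\{x\in X:|x|\wedge w\in V\}$, where $V$ runs over a base of solid $\tau$-neighborhoods of zero and $0\ne w\in X_+$; a net $x_\alpha$ converges to $x$ in it iff $|x_\alpha-x|\wedge w\to 0$ in $\tau$ for all $w\in X_+$. An orthogonal system is a collection $\{e_\gamma\}_{\gamma\in\Gamma}$ of positive vectors with $e_\gamma\wedge e_{\gamma'}=0$ for all $\gamma\ne\gamma'$. An orthogonal system $Q$ of non-zero elements of $X_+$ is a topological orthogonal system if the (order) ideal $I_Q$ generated by $Q$ is $\tau$-dense in $X$. *)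

theory Defs
  imports "HOL-Analysis.Analysis" "HOL-Library.Lattice_Algebras"
begin

class vector_lattice = ordered_real_vector + lattice_ab_group_add_abs

instance real :: vector_lattice ..

definition solid :: "'a::vector_lattice set \<Rightarrow> bool" where
  "solid A \<longleftrightarrow> (\<forall>x y. y \<in> A \<and> \<bar>x\<bar> \<le> \<bar>y\<bar> \<longrightarrow> x \<in> A)"

definition linear_topology :: "'a::real_vector topology \<Rightarrow> bool" where
  "linear_topology \<tau> \<longleftrightarrow>
     topspace \<tau> = UNIV \<and>
     continuous_map (prod_topology \<tau> \<tau>) \<tau> (\<lambda>(x, y). x + y) \<and>
     continuous_map (prod_topology euclideanreal \<tau>) \<tau> (\<lambda>(c, x). c *\<^sub>R x)"

definition locally_solid :: "'a::vector_lattice topology \<Rightarrow> bool" where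
  "locally_solid \<tau> \<longleftrightarrow>
     linear_topology \<tau> \<and> Hausdorff_space \<tau> \<and> neighbourhood_base_at 0 solid \<tau>"

text \<open>Neighbourhoods need not be open.\<close>

definition zero_nbhd :: "'a::zero topology \<Rightarrow> 'a set \<Rightarrow> bool" where
  "zero_nbhd \<tau> V \<longleftrightarrow> (\<exists>U. openin \<tau> U \<and> 0 \<in> U \<and> U \<subseteq> V)"

text \<open>
  Completeness refers to the translation-invariant uniformity of a linear topology; filters
  play the role of nets.
\<close>

definition cauchy_filter_in :: "'a::ab_group_add topology \<Rightarrow> 'a filter \<Rightarrow> bool" where
  "cauchy_filter_in \<tau> F \<longleftrightarrow>
     (\<forall>V. zero_nbhd \<tau> V \<longrightarrow> eventually (\<lambda>(x, y). x - y \<in> V) (F \<times>\<^sub>F F))"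

definition complete_linear_topology :: "'a::ab_group_add topology \<Rightarrow> bool" where
  "complete_linear_topology \<tau> \<longleftrightarrow>
     (\<forall>F. F \<noteq> bot \<and> cauchy_filter_in \<tau> F \<longrightarrow> (\<exists>l. limitin \<tau> (\<lambda>x. x) l F))"

definition unbounded_nbhd :: "'a::vector_lattice set \<Rightarrow> 'a \<Rightarrow> 'a set" where
  "unbounded_nbhd V w = {x. inf \<bar>x\<bar> w \<in> V}"

text \<open>
  The case \<open>w = 0\<close> is admitted below. It contributes only the whole space, so it matters only
  for the zero lattice, where without it there would be no neighbourhoods at all; see
  \<open>openin_unbounded_topology_nonzero\<close>.
\<close>

definition unbounded_topology :: "'a::vector_lattice topology \<Rightarrow> 'a topology" where
  "unbounded_topology \<tau> = topology (\<lambda>S. \<forall>x\<in>S. \<exists>V w.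
     zero_nbhd \<tau> V \<and> solid V \<and> 0 \<le> w \<and> (+) x ` unbounded_nbhd V w \<subseteq> S)"

definition order_ideal :: "'a::vector_lattice set \<Rightarrow> bool" where
  "order_ideal I \<longleftrightarrow> subspace I \<and> solid I"

definition orthogonal_system :: "'a::vector_lattice set \<Rightarrow> bool" where
  "orthogonal_system Q \<longleftrightarrow>
     (\<forall>e\<in>Q. 0 \<le> e) \<and> (\<forall>e\<in>Q. \<forall>e'\<in>Q. e \<noteq> e' \<longrightarrow> inf e e' = 0)"

definition topological_orthogonal_system :: "'a::vector_lattice topology \<Rightarrow> 'a set \<Rightarrow> bool" where
  "topological_orthogonal_system \<tau> Q \<longleftrightarrow>
     orthogonal_system Q \<and> 0 \<notin> Q \<and> \<tau> closure_of (order_ideal hull Q) = topspace \<tau>"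

lemma zero_nbhd_Int: "zero_nbhd \<tau> U \<Longrightarrow> zero_nbhd \<tau> V \<Longrightarrow> zero_nbhd \<tau> (U \<inter> V)"
  unfolding zero_nbhd_def by (metis IntI Int_mono openin_Int)

lemma zero_nbhd_0: "zero_nbhd \<tau> V \<Longrightarrow> 0 \<in> V"
  by (auto simp: zero_nbhd_def)

lemma solid_Int: "solid U \<Longrightarrow> solid V \<Longrightarrow> solid (U \<inter> V)"
  unfolding solid_def by blast

lemma order_ideal_hull: "order_ideal (order_ideal hull Q)"
proof (rule hull_in)
  fix T :: "'a set set" assume "Ball T order_ideal"
  then show "order_ideal (\<Inter>T)"
    unfolding order_ideal_def solid_def by (metis Inter_iff subspace_Inter)
qed

lemma unbounded_nbhd_mono:
  assumes "solid V" "0 \<le> w" "w \<le> w'" "V \<subseteq> V'"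
  shows "unbounded_nbhd V w' \<subseteq> unbounded_nbhd V' w"
proof
  fix x assume "x \<in> unbounded_nbhd V w'"
  then have "inf \<bar>x\<bar> w' \<in> V" by (simp add: unbounded_nbhd_def)
  moreover have "\<bar>inf \<bar>x\<bar> w\<bar> \<le> \<bar>inf \<bar>x\<bar> w'\<bar>"
  proof -
    have "0 \<le> inf \<bar>x\<bar> w" "0 \<le> inf \<bar>x\<bar> w'"
      using assms(2,3) by (simp_all only: le_inf_iff abs_ge_zero simp_thms order_trans[OF assms(2,3)])
    moreover have "inf \<bar>x\<bar> w \<le> inf \<bar>x\<bar> w'"
      using assms(3) by (rule inf_mono[OF order_refl])
    ultimately show ?thesis by (simp only: abs_of_nonneg)
  qed
  ultimately have "inf \<bar>x\<bar> w \<in> V"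
    using \<open>solid V\<close> unfolding solid_def by blast
  then show "x \<in> unbounded_nbhd V' w"
    using \<open>V \<subseteq> V'\<close> by (auto simp: unbounded_nbhd_def)
qed

lemma openin_unbounded_topology:
  "openin (unbounded_topology \<tau>) S \<longleftrightarrow> (\<forall>x\<in>S. \<exists>V w.
     zero_nbhd \<tau> V \<and> solid V \<and> 0 \<le> w \<and> (+) x ` unbounded_nbhd V w \<subseteq> S)"
proof -
  define P where "P = (\<lambda>S::'a set. \<forall>x\<in>S. \<exists>V w.
     zero_nbhd \<tau> V \<and> solid V \<and> 0 \<le> w \<and> (+) x ` unbounded_nbhd V w \<subseteq> S)"
  have "P (S \<inter> T)" if S: "P S" and T: "P T" for S T
    unfolding P_def
  proof
    fix x assume x: "x \<in> S \<inter> T"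
    obtain V w where V: "zero_nbhd \<tau> V" "solid V" "0 \<le> w" "(+) x ` unbounded_nbhd V w \<subseteq> S"
      using S x unfolding P_def by blast
    obtain V' w' where V': "zero_nbhd \<tau> V'" "solid V'" "0 \<le> w'" "(+) x ` unbounded_nbhd V' w' \<subseteq> T"
      using T x unfolding P_def by blast
    have sol: "solid (V \<inter> V')" using V V' by (simp add: solid_Int)
    have "unbounded_nbhd (V \<inter> V') (sup w w') \<subseteq> unbounded_nbhd V w \<inter> unbounded_nbhd V' w'"
      using unbounded_nbhd_mono[OF sol V(3), of "sup w w'" V]
        unbounded_nbhd_mono[OF sol V'(3), of "sup w w'" V'] by simp
    then have "(+) x ` unbounded_nbhd (V \<inter> V') (sup w w') \<subseteq> S \<inter> T"
      using V(4) V'(4) by blast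
    moreover have "0 \<le> sup w w'" using V(3) by (simp add: le_supI1)
    ultimately show "\<exists>V w. zero_nbhd \<tau> V \<and> solid V \<and> 0 \<le> w \<and> (+) x ` unbounded_nbhd V w \<subseteq> S \<inter> T"
      using sol zero_nbhd_Int[OF V(1) V'(1)] by blast
  qed
  moreover have "P (\<Union>K)" if "\<forall>S\<in>K. P S" for K
    using that unfolding P_def by (meson Union_iff Union_upper subset_trans)
  ultimately have "istopology P"
    unfolding istopology_def by blast
  then show ?thesis
    unfolding unbounded_topology_def by (fold P_def) (simp add: P_def)
qed

lemma openin_unbounded_topology_nonzero:
  assumes "\<exists>x::'a::vector_lattice. x \<noteq> 0"
  shows "openin (unbounded_topology \<tau>) S \<longleftrightarrow> (\<forall>x\<in>S. \<exists>V w.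
     zero_nbhd \<tau> V \<and> solid V \<and> 0 \<le> w \<and> w \<noteq> (0::'a) \<and> (+) x ` unbounded_nbhd V w \<subseteq> S)"
proof -
  obtain u :: 'a where "u \<noteq> 0" using assms by blast
  then have u: "0 \<le> \<bar>u\<bar>" "\<bar>u\<bar> \<noteq> 0" by simp_all
  have "unbounded_nbhd V \<bar>u\<bar> \<subseteq> unbounded_nbhd V 0" if "solid V" for V
    using unbounded_nbhd_mono[of V 0 "\<bar>u\<bar>" V] that u by simp
  then have "\<exists>w\<ge>0. w \<noteq> 0 \<and> (+) x ` unbounded_nbhd V w \<subseteq> S"
    if "solid V" "0 \<le> w" "(+) x ` unbounded_nbhd V w \<subseteq> S" for V w x
    using that u by (cases "w = 0") blast+
  then show ?thesis
    unfolding openin_unbounded_topology by meson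
qed

lemma inf_abs_add_le:
  fixes x y w :: "'a::vector_lattice"
  assumes "0 \<le> w"
  shows "inf \<bar>x + y\<bar> w \<le> inf \<bar>x\<bar> w + inf \<bar>y\<bar> w"
proof -
  have "inf \<bar>x + y\<bar> w \<le> inf (\<bar>x\<bar> + \<bar>y\<bar>) w"
    by (meson abs_triangle_ineq inf_mono order_refl)
  moreover have "inf (\<bar>x\<bar> + \<bar>y\<bar>) w \<le> inf \<bar>x\<bar> w + \<bar>y\<bar>"
    unfolding add_inf_distrib_right using assms by (simp add: le_infI2)
  moreover have "inf (\<bar>x\<bar> + \<bar>y\<bar>) w \<le> inf \<bar>x\<bar> w + w"
    using assms by (simp add: add_increasing le_infI2)
  ultimately show ?thesis
    unfolding add_inf_distrib_left by (meson le_infI order_trans)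
qed

lemma zero_nbhd_half:
  fixes \<tau> :: "'a::vector_lattice topology"
  assumes ls: "locally_solid \<tau>" and V: "zero_nbhd \<tau> V"
  obtains V' where "zero_nbhd \<tau> V'" "solid V'" "\<And>a b. a \<in> V' \<Longrightarrow> b \<in> V' \<Longrightarrow> a + b \<in> V"
proof -
  obtain W where W: "openin \<tau> W" "0 \<in> W" "W \<subseteq> V"
    using V by (auto simp: zero_nbhd_def)
  have top: "topspace \<tau> = UNIV"
    and "continuous_map (prod_topology \<tau> \<tau>) \<tau> (\<lambda>(x, y). x + y)"
    using ls by (auto simp: locally_solid_def linear_topology_def)
  then have "openin (prod_topology \<tau> \<tau>)
      {p \<in> topspace (prod_topology \<tau> \<tau>). (\<lambda>(x, y). x + y) p \<in> W}"
    using W(1) by (rule_tac openin_continuous_map_preimage)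
  moreover have "(0, 0) \<in> {p \<in> topspace (prod_topology \<tau> \<tau>). (\<lambda>(x, y). x + y) p \<in> W}"
    using W(2) top by simp
  ultimately obtain A B where AB: "openin \<tau> A" "openin \<tau> B" "0 \<in> A" "0 \<in> B"
    "A \<times> B \<subseteq> {p \<in> topspace (prod_topology \<tau> \<tau>). (\<lambda>(x, y). x + y) p \<in> W}"
    unfolding openin_prod_topology_alt by meson
  have "neighbourhood_base_at 0 solid \<tau>" using ls by (simp add: locally_solid_def)
  then obtain U V' where "openin \<tau> U" "solid V'" "0 \<in> U" "U \<subseteq> V'" "V' \<subseteq> A \<inter> B"
    unfolding neighbourhood_base_at_def using openin_Int[OF AB(1,2)] IntI[OF AB(3,4)] by meson
  then have V': "zero_nbhd \<tau> V'" "solid V'" "V' \<times> V' \<subseteq> A \<times> B"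
    by (auto simp: zero_nbhd_def)
  have "a + b \<in> V" if "a \<in> V'" "b \<in> V'" for a b
  proof -
    have "(a, b) \<in> A \<times> B" using that V'(3) by blast
    with AB(5) have "(a, b) \<in> {p \<in> topspace (prod_topology \<tau> \<tau>). (\<lambda>(x, y). x + y) p \<in> W}" ..
    then show ?thesis using W(3) by auto
  qed
  with V' show thesis by (intro that[of V'])
qed


lemma nbhd_unbounded_topology:
  fixes \<tau> :: "'a::vector_lattice topology"
  assumes ls: "locally_solid \<tau>"
  shows "(\<exists>U. openin (unbounded_topology \<tau>) U \<and> x \<in> U \<and> U \<subseteq> N) \<longleftrightarrow>
    (\<exists>V w. zero_nbhd \<tau> V \<and> solid V \<and> 0 \<le> w \<and> (+) x ` unbounded_nbhd V w \<subseteq> N)"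
proof
  assume "\<exists>U. openin (unbounded_topology \<tau>) U \<and> x \<in> U \<and> U \<subseteq> N"
  then show "\<exists>V w. zero_nbhd \<tau> V \<and> solid V \<and> 0 \<le> w \<and> (+) x ` unbounded_nbhd V w \<subseteq> N"
    unfolding openin_unbounded_topology by (meson subset_trans)
next
  assume R: "\<exists>V w. zero_nbhd \<tau> V \<and> solid V \<and> 0 \<le> w \<and> (+) x ` unbounded_nbhd V w \<subseteq> N"
  define P where "P = (\<lambda>y. \<exists>V w. zero_nbhd \<tau> V \<and> solid V \<and> 0 \<le> w \<and> (+) y ` unbounded_nbhd V w \<subseteq> N)"
  have "\<exists>V w. zero_nbhd \<tau> V \<and> solid V \<and> 0 \<le> w \<and> (+) y ` unbounded_nbhd V w \<subseteq> Collect P"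
    if Py: "P y" for y
  proof -
    obtain V w where V: "zero_nbhd \<tau> V" "solid V" "0 \<le> w" "(+) y ` unbounded_nbhd V w \<subseteq> N"
      using Py unfolding P_def by blast
    obtain V' where V': "zero_nbhd \<tau> V'" "solid V'" "\<And>a b. a \<in> V' \<Longrightarrow> b \<in> V' \<Longrightarrow> a + b \<in> V"
      using zero_nbhd_half[OF ls V(1)] by metis
    have "a + b \<in> unbounded_nbhd V w" if "a \<in> unbounded_nbhd V' w" "b \<in> unbounded_nbhd V' w" for a b
    proof -
      have "inf \<bar>a\<bar> w + inf \<bar>b\<bar> w \<in> V" using that V'(3) by (simp add: unbounded_nbhd_def)
      moreover have "\<bar>inf \<bar>a + b\<bar> w\<bar> \<le> \<bar>inf \<bar>a\<bar> w + inf \<bar>b\<bar> w\<bar>"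
        using inf_abs_add_le[OF V(3), of a b] V(3) by (subst (1 2) abs_of_nonneg) simp_all
      ultimately show ?thesis
        using V(2) unfolding solid_def unbounded_nbhd_def by blast
    qed
    then have "P (y + a)" if "a \<in> unbounded_nbhd V' w" for a
      unfolding P_def using V(3,4) V'(1,2) that
      by (intro exI[of _ V'] exI[of _ w]) (auto simp: add.assoc)
    then show ?thesis using V' V(3) by (intro exI[of _ V'] exI[of _ w]) auto
  qed
  then have "openin (unbounded_topology \<tau>) (Collect P)"
    unfolding openin_unbounded_topology by simp
  moreover have "x \<in> Collect P" using R by (simp add: P_def)
  moreover have "Collect P \<subseteq> N"
  proof
    fix y assume "y \<in> Collect P"
    then obtain V w where V: "zero_nbhd \<tau> V" "solid V" "0 \<le> w" "(+) y ` unbounded_nbhd V w \<subseteq> N"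
      unfolding P_def by blast
    moreover have "0 \<in> unbounded_nbhd V w"
      using V by (simp add: unbounded_nbhd_def zero_nbhd_0 inf.absorb1)
    ultimately show "y \<in> N" by force
  qed
  ultimately show "\<exists>U. openin (unbounded_topology \<tau>) U \<and> x \<in> U \<and> U \<subseteq> N" by blast
qed

lemma topspace_unbounded_topology [simp]:
  assumes "locally_solid \<tau>" shows "topspace (unbounded_topology \<tau>) = UNIV"
proof -
  have "zero_nbhd \<tau> UNIV" "solid UNIV"
    using assms by (auto simp: zero_nbhd_def solid_def locally_solid_def linear_topology_def
        intro!: exI[of _ "topspace \<tau>"])
  then have "openin (unbounded_topology \<tau>) UNIV"
    unfolding openin_unbounded_topology by (metis order_refl subset_UNIV)
  then show ?thesis using openin_subset by fastforce
qed

lemma limitin_unbounded_topology: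
  fixes \<tau> :: "'a::vector_lattice topology"
  assumes ls: "locally_solid \<tau>"
  shows "limitin (unbounded_topology \<tau>) f x F \<longleftrightarrow>
    (\<forall>w. 0 \<le> w \<longrightarrow> limitin \<tau> (\<lambda>a. inf \<bar>f a - x\<bar> w) 0 F)" (is "?L \<longleftrightarrow> ?R")
proof -
  have top: "topspace \<tau> = UNIV"
    using ls by (simp add: locally_solid_def linear_topology_def)
  have mem: "y \<in> (+) x ` unbounded_nbhd V w \<longleftrightarrow> inf \<bar>y - x\<bar> w \<in> V" for y V w
    by (force simp: unbounded_nbhd_def image_iff intro: exI[of _ "y - x"])
  show ?thesis
  proof
    assume L: ?L
    show ?R
      unfolding limitin_def
    proof (intro allI impI conjI)
      fix w U assume w: "0 \<le> (w::'a)" and U: "openin \<tau> U \<and> 0 \<in> U"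
      have "neighbourhood_base_at 0 solid \<tau>" using ls by (simp add: locally_solid_def)
      then obtain U' V where "openin \<tau> U'" "0 \<in> U'" "U' \<subseteq> V" and V: "solid V" "V \<subseteq> U"
        unfolding neighbourhood_base_at_def using U by meson
      then have V0: "zero_nbhd \<tau> V"
        by (auto simp: zero_nbhd_def)
      then obtain S where S: "openin (unbounded_topology \<tau>) S" "x \<in> S"
          "S \<subseteq> (+) x ` unbounded_nbhd V w"
        using nbhd_unbounded_topology[OF ls, of x "(+) x ` unbounded_nbhd V w"] V0 V(1) w
        by (meson order_refl)
      have "\<forall>\<^sub>F a in F. f a \<in> S" using L S unfolding limitin_def by blast
      then show "\<forall>\<^sub>F a in F. inf \<bar>f a - x\<bar> w \<in> U"
      proof eventually_elim
        case (elim a)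
        then have "inf \<bar>f a - x\<bar> w \<in> V" using S(3) mem[of "f a" V w] by auto
        then show ?case using V(2) by auto
      qed
    qed (simp add: top)
  next
    assume R: ?R
    show ?L
      unfolding limitin_def
    proof (intro allI impI conjI)
      fix S assume "openin (unbounded_topology \<tau>) S \<and> x \<in> S"
      then obtain V w where V: "zero_nbhd \<tau> V" "0 \<le> w" "(+) x ` unbounded_nbhd V w \<subseteq> S"
        unfolding openin_unbounded_topology by blast
      obtain U where U: "openin \<tau> U" "0 \<in> U" "U \<subseteq> V"
        using V(1) by (auto simp: zero_nbhd_def)
      have "\<forall>\<^sub>F a in F. inf \<bar>f a - x\<bar> w \<in> U"
        using R V(2) U unfolding limitin_def by blast
      then show "\<forall>\<^sub>F a in F. f a \<in> S"
      proof eventually_elim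
        case (elim a)
        then have "f a \<in> (+) x ` unbounded_nbhd V w" using U(3) mem[of "f a" V w] by auto
        then show ?case using V(3) by auto
      qed
    qed (simp add: ls)
  qed
qed

end

theory Submission
  imports Defs
begin

text \<open>
  A countable base of zero neighbourhoods suffices, since a Hausdorff group topology with such
  a base is metrizable (Birkhoff--Kakutani). Enumerate \<open>Q\<close> as \<open>e\<^sub>0, e\<^sub>1, \<dots>\<close>
  and put \<open>a\<^sub>n = n (e\<^sub>0 + \<dots> + e\<^sub>n\<^sub>-\<^sub>1)\<close>. Every element of the ideal
  generated by \<open>Q\<close> is dominated by some \<open>a\<^sub>n\<close>. If \<open>y\<close> in the ideal is close to \<open>w\<close>
  and \<open>\<bar>y\<bar> \<le> a\<^sub>n\<close>, then
  \<open>\<bar>x\<bar> \<and> w \<le> \<bar>x\<bar> \<and> a\<^sub>n + \<bar>w - y\<bar>\<close>; so the sets \<open>unbounded_nbhd V\<^sub>n a\<^sub>n\<close>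
  form a base at zero when the \<open>V\<^sub>n\<close> form a solid base for \<open>\<tau>\<close>.
\<close>

section \<open>Metrization of group topologies\<close>

text \<open>The pivot \<open>m\<close> is the entry at which the partial sums cross half the total:
  what precedes it is at most half, what follows is less than half. Both pieces are shorter than
  \<open>xs\<close>, as an induction on length requires.\<close>

lemma sum_list_split_half:
  fixes f :: "'b \<Rightarrow> real"
  assumes "xs \<noteq> []" "\<And>x. x \<in> set xs \<Longrightarrow> 0 \<le> f x"
  obtains as m bs where "xs = as @ m # bs"
    "sum_list (map f as) \<le> sum_list (map f xs) / 2"
    "sum_list (map f bs) \<le> sum_list (map f xs) / 2"
proof -
  define S where "S = sum_list (map f xs)"
  have S0: "0 \<le> S"
    unfolding S_def using assms(2) by (intro sum_list_nonneg) auto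
  define k where "k = (GREATEST k. k \<le> length xs \<and> sum_list (map f (take k xs)) \<le> S / 2)"
  have k: "k \<le> length xs \<and> sum_list (map f (take k xs)) \<le> S / 2"
    unfolding k_def by (rule GreatestI_nat[where k = 0 and b = "length xs"]) (use S0 in auto)
  have above: "j \<le> k" if "j \<le> length xs" "sum_list (map f (take j xs)) \<le> S / 2" for j
    unfolding k_def by (rule Greatest_le_nat[where b = "length xs"]) (use that in auto)
  show thesis
  proof (cases "k < length xs")
    case True
    have "S = sum_list (map f (take (Suc k) xs)) + sum_list (map f (drop (Suc k) xs))"
      unfolding S_def by (metis append_take_drop_id map_append sum_list_append)
    moreover have "\<not> sum_list (map f (take (Suc k) xs)) \<le> S / 2"
      using above[of "Suc k"] True by auto
    ultimately show thesis
      using k True by (intro that[of "take k xs" "xs ! k" "drop (Suc k) xs"])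
        (auto simp: S_def id_take_nth_drop[symmetric])
  next
    case False
    \<comment> \<open>Here the whole sum is at most half of itself, so all weights vanish and any
      split will do.\<close>
    then have "S = 0" using k S0 by (simp add: S_def)
    then have "\<forall>x\<in>set xs. f x = 0"
      using sum_list_nonneg_eq_0_iff[of "map f xs"] assms(2) by (auto simp: S_def)
    moreover obtain m bs where "xs = m # bs" using assms(1) by (cases xs) auto
    ultimately show thesis using S0
      by (intro that[of "[]" m bs]) (auto simp: S_def cong: map_cong)
  qed
qed

section \<open>The Birkhoff-Kakutani norm of a sequence of sets\<close>

text \<open>A chain writes a group element as a finite sum. Each summand carries an index
  \<open>n\<close>, since it may lie in several sets \<open>W n\<close> and the index determines its
  cost.\<close>

definition chain_in :: "(nat \<Rightarrow> 'a set) \<Rightarrow> ('a \<times> nat) list \<Rightarrow> bool" where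
  "chain_in W ps \<longleftrightarrow> (\<forall>(x, n)\<in>set ps. x \<in> W n)"

definition chain_cost :: "('a \<times> nat) list \<Rightarrow> real" where
  "chain_cost ps = sum_list (map (\<lambda>p. (1 / 2) ^ snd p) ps)"

text \<open>The Birkhoff-Kakutani gauge: taking the infimum over all decompositions, rather than the
  best single index, is what yields the triangle inequality.\<close>

definition chain_norm :: "(nat \<Rightarrow> 'a set) \<Rightarrow> 'a::ab_group_add \<Rightarrow> real" where
  "chain_norm W x = Inf (chain_cost ` {ps. chain_in W ps \<and> sum_list (map fst ps) = x})"

lemma chain_cost_nonneg: "0 \<le> chain_cost ps"
  unfolding chain_cost_def by (intro sum_list_nonneg) auto

lemma chain_cost_append [simp]: "chain_cost (ps @ qs) = chain_cost ps + chain_cost qs"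
  by (simp add: chain_cost_def)

lemma chain_cost_Cons [simp]: "chain_cost (p # ps) = (1 / 2) ^ snd p + chain_cost ps"
  by (simp add: chain_cost_def)

lemma chain_in_append [simp]: "chain_in W (ps @ qs) \<longleftrightarrow> chain_in W ps \<and> chain_in W qs"
  by (auto simp: chain_in_def)

lemma chain_in_Cons [simp]: "chain_in W (p # ps) \<longleftrightarrow> fst p \<in> W (snd p) \<and> chain_in W ps"
  by (auto simp: chain_in_def)

context
  fixes W :: "nat \<Rightarrow> 'a::ab_group_add set"
  assumes W_0: "W 0 = UNIV"
    and zero_mem: "\<And>n. 0 \<in> W n"
    and uminus_mem: "\<And>n x. x \<in> W n \<Longrightarrow> - x \<in> W n"
    and add3_mem: "\<And>n x y z. x \<in> W (Suc n) \<Longrightarrow> y \<in> W (Suc n) \<Longrightarrow> z \<in> W (Suc n) \<Longrightarrow> x + y + z \<in> W n"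
begin

lemma W_antimono: "m \<le> n \<Longrightarrow> W n \<subseteq> W m"
proof (induction rule: dec_induct)
  case (step n)
  have "W (Suc n) \<subseteq> W n" using add3_mem[OF _ zero_mem zero_mem] by auto
  with step show ?case by blast
qed simp

text \<open>Splitting at a pivot leaves three parts, hence the threefold sums in
  \<open>add3_mem\<close>. Prefix and suffix have at most half the cost and fall under the induction
  hypothesis at \<open>Suc n\<close>; the strict bound on the cost forces the index of the pivot
  above \<open>n\<close>.\<close>

lemma sum_list_chain_mem:
  assumes "chain_in W ps" "chain_cost ps < (1 / 2) ^ n"
  shows "sum_list (map fst ps) \<in> W n"
  using assms
proof (induction "length ps" arbitrary: ps n rule: less_induct)
  case less
  show ?case
  proof (cases "ps = []")
    case False
    obtain as m bs where ps: "ps = as @ m # bs"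
      and half: "chain_cost as \<le> chain_cost ps / 2" "chain_cost bs \<le> chain_cost ps / 2"
      using sum_list_split_half[OF False, of "\<lambda>p. (1 / 2) ^ snd p"]
      unfolding chain_cost_def by (metis zero_le_power zero_le_divide_1_iff zero_le_numeral)
    have "chain_cost as < (1 / 2) ^ Suc n" "chain_cost bs < (1 / 2) ^ Suc n"
      using half less.prems by auto
    then have "sum_list (map fst as) \<in> W (Suc n)" "sum_list (map fst bs) \<in> W (Suc n)"
      using less.hyps less.prems ps by auto
    moreover have "(1 / 2 :: real) ^ snd m < (1 / 2) ^ n"
      using less.prems(2) chain_cost_nonneg[of as] chain_cost_nonneg[of bs]
      unfolding ps chain_cost_append chain_cost_Cons by linarith
    then have "n < snd m"
      using power_strict_decreasing_iff[of "1 / 2 :: real" "snd m" n] by simp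
    then have "fst m \<in> W (Suc n)"
      using W_antimono[of "Suc n" "snd m"] less.prems(1) by (auto simp: ps)
    ultimately show ?thesis
      using add3_mem by (simp add: ps add.assoc)
  qed (simp add: zero_mem)
qed

lemma chain_norm_le:
  "chain_in W ps \<Longrightarrow> sum_list (map fst ps) = x \<Longrightarrow> chain_norm W x \<le> chain_cost ps"
  unfolding chain_norm_def
  by (intro cInf_lower bdd_belowI[of _ 0]) (auto simp: chain_cost_nonneg)

lemma chain_norm_lessE:
  assumes "chain_norm W x < r"
  obtains ps where "chain_in W ps" "sum_list (map fst ps) = x" "chain_cost ps < r"
proof -
  \<comment> \<open>Since \<open>W 0\<close> is everything, this one-term chain shows that the
    infimum is not over the empty set, where its value would be unspecified.\<close>
  have "[(x, 0)] \<in> {ps. chain_in W ps \<and> sum_list (map fst ps) = x}"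
    by (simp add: chain_in_def W_0)
  then have "chain_cost ` {ps. chain_in W ps \<and> sum_list (map fst ps) = x} \<noteq> {}" by blast
  from cInf_lessD[OF this] assms that show thesis unfolding chain_norm_def by blast
qed

lemma chain_norm_nonneg: "0 \<le> chain_norm W x"
proof (rule ccontr)
  assume "\<not> 0 \<le> chain_norm W x"
  then have "chain_norm W x < 0" by simp
  then obtain ps where "chain_in W ps" "sum_list (map fst ps) = x" "chain_cost ps < 0"
    by (rule chain_norm_lessE)
  with chain_cost_nonneg[of ps] show False by simp
qed

lemma chain_norm_less_imp_mem: "chain_norm W x < (1 / 2) ^ n \<Longrightarrow> x \<in> W n"
  by (metis chain_norm_lessE sum_list_chain_mem)

lemma chain_norm_le_power: "x \<in> W n \<Longrightarrow> chain_norm W x \<le> (1 / 2) ^ n"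
  using chain_norm_le[of "[(x, n)]" x] by (simp add: chain_in_def chain_cost_def)

text \<open>Concatenating near-optimal chains adds their costs; the slack \<open>e\<close> allows
  for infima that are not attained.\<close>

lemma chain_norm_triangle: "chain_norm W (x + y) \<le> chain_norm W x + chain_norm W y"
proof (rule field_le_epsilon)
  fix e :: real assume "0 < e"
  obtain ps where ps: "chain_in W ps" "sum_list (map fst ps) = x" "chain_cost ps < chain_norm W x + e / 2"
    using chain_norm_lessE[of x "chain_norm W x + e / 2"] \<open>0 < e\<close> by auto
  obtain qs where qs: "chain_in W qs" "sum_list (map fst qs) = y" "chain_cost qs < chain_norm W y + e / 2"
    using chain_norm_lessE[of y "chain_norm W y + e / 2"] \<open>0 < e\<close> by auto
  have "chain_norm W (x + y) \<le> chain_cost (ps @ qs)"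
    using ps qs by (intro chain_norm_le) auto
  then show "chain_norm W (x + y) \<le> chain_norm W x + chain_norm W y + e"
    using ps qs by simp
qed

text \<open>Negating every entry of a chain keeps its indices and hence its cost.\<close>

lemma chain_norm_uminus_le: "chain_norm W (- x) \<le> chain_norm W x"
proof (rule dense_ge)
  fix r assume "chain_norm W x < r"
  then obtain ps where ps: "chain_in W ps" "sum_list (map fst ps) = x" "chain_cost ps < r"
    by (rule chain_norm_lessE)
  let ?qs = "map (\<lambda>(x, n). (- x, n)) ps"
  have "chain_in W ?qs" using ps(1) uminus_mem by (auto simp: chain_in_def)
  moreover have "sum_list (map fst ?qs) = - x"
    using ps(2) uminus_sum_list_map[of fst ps] by (simp add: case_prod_beta comp_def)
  ultimately have "chain_norm W (- x) \<le> chain_cost ?qs" by (rule chain_norm_le)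
  also have "chain_cost ?qs = chain_cost ps"
    by (simp add: chain_cost_def case_prod_beta comp_def)
  finally show "chain_norm W (- x) \<le> r" using ps(3) by simp
qed

lemma chain_norm_eq_0_iff:
  assumes "(\<Inter>n. W n) = {0}"
  shows "chain_norm W x = 0 \<longleftrightarrow> x = 0"
proof
  assume "chain_norm W x = 0"
  then have "x \<in> W n" for n by (intro chain_norm_less_imp_mem) simp
  then show "x = 0" using assms by blast
next
  assume "x = 0"
  then show "chain_norm W x = 0"
    \<comment> \<open>The empty chain represents \<open>0\<close> at cost \<open>0\<close>.\<close>
    using chain_norm_le[of "[]" x] chain_norm_nonneg[of x] by (simp add: chain_in_def chain_cost_def)
qed

section \<open>From the norm to a metric\<close>

text \<open>The gauge of a difference is a translation-invariant metric. It induces \<open>T\<close>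
  because \<open>W n\<close> contains the open gauge ball of radius \<open>(1 / 2) ^ n\<close> about
  \<open>0\<close> and lies in the closed one.\<close>

lemma metrizable_space_chain:
  assumes Inter: "(\<Inter>n. W n) = {0}"
    and openin: "\<And>S. openin T S \<longleftrightarrow> (\<forall>x\<in>S. \<exists>n. (+) x ` W n \<subseteq> S)"
  shows "metrizable_space T"
proof -
  have sym: "chain_norm W (x - y) = chain_norm W (y - x)" for x y
    using chain_norm_uminus_le[of "x - y"] chain_norm_uminus_le[of "y - x"] by simp
  interpret Metric_space UNIV "\<lambda>x y. chain_norm W (x - y)"
  proof
    show "chain_norm W (x - z) \<le> chain_norm W (x - y) + chain_norm W (y - z)" for x y z
      using chain_norm_triangle[of "x - y" "y - z"] by simp
  qed (use sym chain_norm_nonneg chain_norm_eq_0_iff[OF Inter] in auto)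
  have "(\<exists>n. (+) x ` W n \<subseteq> S) \<longleftrightarrow> (\<exists>r>0. mball x r \<subseteq> S)" for x S
  proof
    assume "\<exists>n. (+) x ` W n \<subseteq> S"
    then obtain n where n: "(+) x ` W n \<subseteq> S" ..
    have "mball x ((1 / 2) ^ n) \<subseteq> S"
    proof
      fix y assume "y \<in> mball x ((1 / 2) ^ n)"
      then have "y - x \<in> W n" using sym chain_norm_less_imp_mem by auto
      then have "x + (y - x) \<in> S" using n by blast
      then show "y \<in> S" by simp
    qed
    then show "\<exists>r>0. mball x r \<subseteq> S" by (intro exI[of _ "(1 / 2) ^ n"]) simp
  next
    assume "\<exists>r>0. mball x r \<subseteq> S"
    then obtain r where r: "r > 0" "mball x r \<subseteq> S" by blast
    obtain n where "(1 / 2 :: real) ^ n < r"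
      using real_arch_pow_inv[OF r(1), of "1 / 2"] by auto
    \<comment> \<open>The distance from \<open>x\<close> to \<open>x + y\<close> is the gauge of
      \<open>- y\<close>, hence the appeal to the symmetry of \<open>W n\<close>.\<close>
    then have "chain_norm W (x - (x + y)) < r" if "y \<in> W n" for y
      using chain_norm_le_power[OF uminus_mem[OF that]] by simp
    then show "\<exists>n. (+) x ` W n \<subseteq> S"
      using r(2) by (intro exI[of _ n]) auto
  qed
  then have "T = mtopology"
    by (auto simp: topology_eq openin openin_mtopology)
  then show ?thesis by (simp add: metrizable_space_mtopology)
qed

end

text \<open>The proof prepends the whole space to the sequence, so that every element has a chain.\<close>

lemma metrizable_space_group_topology:
  fixes W :: "nat \<Rightarrow> 'a::ab_group_add set"
  assumes "\<And>n x. x \<in> W n \<Longrightarrow> - x \<in> W n"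
    and "\<And>n x y z. x \<in> W (Suc n) \<Longrightarrow> y \<in> W (Suc n) \<Longrightarrow> z \<in> W (Suc n) \<Longrightarrow> x + y + z \<in> W n"
    and Inter: "(\<Inter>n. W n) = {0}"
    and openin: "\<And>S. openin T S \<longleftrightarrow> (\<forall>x\<in>S. \<exists>n. (+) x ` W n \<subseteq> S)"
  shows "metrizable_space T"
proof (rule metrizable_space_chain[where W = "case_nat UNIV W"])
  have zero: "0 \<in> W n" for n using Inter by blast
  then show "0 \<in> (case n of 0 \<Rightarrow> UNIV | Suc k \<Rightarrow> W k)" for n
    by (simp split: nat.split)
  show "(\<Inter>n. case n of 0 \<Rightarrow> UNIV | Suc k \<Rightarrow> W k) = {0}"
    using zero Inter by (auto split: nat.splits)
  show "openin T S \<longleftrightarrow> (\<forall>x\<in>S. \<exists>n. (+) x ` (case n of 0 \<Rightarrow> UNIV | Suc k \<Rightarrow> W k) \<subseteq> S)" for S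
  proof -
    have "(\<exists>n. (+) x ` W n \<subseteq> S) \<longleftrightarrow> (\<exists>n. (+) x ` (case n of 0 \<Rightarrow> UNIV | Suc k \<Rightarrow> W k) \<subseteq> S)" for x
    proof
      assume "\<exists>n. (+) x ` W n \<subseteq> S"
      then obtain n where "(+) x ` W n \<subseteq> S" ..
      then show "\<exists>n. (+) x ` (case n of 0 \<Rightarrow> UNIV | Suc k \<Rightarrow> W k) \<subseteq> S"
        by (intro exI[of _ "Suc n"]) simp
    next
      assume "\<exists>n. (+) x ` (case n of 0 \<Rightarrow> UNIV | Suc k \<Rightarrow> W k) \<subseteq> S"
      then obtain n where "(+) x ` (case n of 0 \<Rightarrow> UNIV | Suc k \<Rightarrow> W k) \<subseteq> S" ..
      \<comment> \<open>For \<open>n = 0\<close> truncated subtraction gives \<open>W 0\<close>,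
        which is covered because \<open>S\<close> then contains the whole translated space.\<close>
      then have "(+) x ` W (n - 1) \<subseteq> S" by (cases n) auto
      then show "\<exists>n. (+) x ` W n \<subseteq> S" ..
    qed
    then show ?thesis by (simp add: openin)
  qed
qed (use assms in \<open>auto split: nat.splits\<close>)

section \<open>The unbounded topology\<close>

lemma solidD: "solid A \<Longrightarrow> y \<in> A \<Longrightarrow> \<bar>x\<bar> \<le> \<bar>y\<bar> \<Longrightarrow> x \<in> A"
  unfolding solid_def by blast

lemma abs_scaleR_le:
  fixes x :: "'a::vector_lattice"
  shows "\<bar>c *\<^sub>R x\<bar> \<le> \<bar>c\<bar> *\<^sub>R \<bar>x\<bar>"
proof (rule abs_leI)
  have "c *\<^sub>R x \<le> \<bar>c\<bar> *\<^sub>R \<bar>x\<bar>" for c and x :: 'a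
  proof (cases "0 \<le> c")
    case False
    then have "(- c) *\<^sub>R (- x) \<le> (- c) *\<^sub>R \<bar>x\<bar>"
      by (intro scaleR_left_mono) (simp_all add: abs_ge_minus_self)
    with False show ?thesis by simp
  qed (simp add: scaleR_left_mono abs_ge_self)
  from this[of c x] this[of "- c" x]
  show "c *\<^sub>R x \<le> \<bar>c\<bar> *\<^sub>R \<bar>x\<bar>" "- (c *\<^sub>R x) \<le> \<bar>c\<bar> *\<^sub>R \<bar>x\<bar>" by simp_all
qed

text \<open>The elements dominated by some \<open>a n\<close> form an order ideal containing
  \<open>Q\<close>, so they include the hull. In \<open>a n\<close> both the number of generators
  and their common coefficient grow with \<open>n\<close>.\<close>

lemma order_ideal_hull_cofinal_sequence:
  fixes Q :: "'a::vector_lattice set"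
  assumes "countable Q" "\<forall>e\<in>Q. 0 \<le> e"
  obtains a :: "nat \<Rightarrow> 'a" where "\<And>n. 0 \<le> a n" "mono a"
    "\<And>y. y \<in> order_ideal hull Q \<Longrightarrow> \<exists>n. \<bar>y\<bar> \<le> a n"
proof -
  \<comment> \<open>Inserting \<open>0\<close> makes the enumerated set nonempty, so that an empty
    \<open>Q\<close> needs no separate case.\<close>
  define e where "e = from_nat_into (insert 0 Q)"
  have range_e: "range e = insert 0 Q"
    unfolding e_def using assms(1) by (intro range_from_nat_into) auto
  then have e0: "0 \<le> e n" for n using assms(2) by (metis insert_iff order_refl rangeI)
  define s where "s n = (\<Sum>k<n. e k)" for n
  define a where "a n = real n *\<^sub>R s n" for n
  have s0: "0 \<le> s n" for n unfolding s_def by (intro sum_nonneg) (simp add: e0)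
  have s_mono: "s m \<le> s n" if "m \<le> n" for m n
    unfolding s_def using that e0 by (intro sum_mono2) auto
  \<comment> \<open>One index has to exceed both the coefficient and the number of summands; all
    closure properties below reduce to this.\<close>
  have a_le: "r *\<^sub>R s m \<le> a n" if "r \<le> real n" "m \<le> n" "0 \<le> r" for r m n
    unfolding a_def using that s_mono s0 by (intro scaleR_mono) auto
  have a0: "0 \<le> a n" for n unfolding a_def using s0 by (intro scaleR_nonneg_nonneg) auto
  have a_mono: "mono a"
    using a_le by (intro monoI) (subst a_def, simp)
  define I where "I = {y. \<exists>n. \<bar>y\<bar> \<le> a n}"
  have "order_ideal I"
    unfolding order_ideal_def
  proof
    show "solid I" unfolding solid_def I_def by (blast intro: order_trans)
    show "subspace I"
      unfolding subspace_def
    proof (intro conjI allI ballI)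
      show "0 \<in> I" using a0 by (auto simp: I_def)
    next
      fix x y assume "x \<in> I" "y \<in> I"
      then obtain m n where mn: "\<bar>x\<bar> \<le> a m" "\<bar>y\<bar> \<le> a n" by (auto simp: I_def)
      let ?k = "max m n"
      have "\<bar>x + y\<bar> \<le> \<bar>x\<bar> + \<bar>y\<bar>" by (rule abs_triangle_ineq)
      also have "\<dots> \<le> a ?k + a ?k"
        using mn monoD[OF a_mono, of m ?k] monoD[OF a_mono, of n ?k]
        by (meson add_mono max.cobounded1 max.cobounded2 order_trans)
      also have "\<dots> = (2 * real ?k) *\<^sub>R s ?k"
        unfolding a_def by (simp flip: scaleR_left_distrib)
      also have "\<dots> \<le> a (2 * ?k)" by (intro a_le) auto
      finally show "x + y \<in> I" by (auto simp: I_def)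
    next
      fix c x assume "x \<in> I"
      then obtain m where m: "\<bar>x\<bar> \<le> a m" by (auto simp: I_def)
      obtain k :: nat where k: "\<bar>c\<bar> \<le> real k" using real_arch_simple by blast
      have "\<bar>c *\<^sub>R x\<bar> \<le> \<bar>c\<bar> *\<^sub>R \<bar>x\<bar>" by (rule abs_scaleR_le)
      also have "\<dots> \<le> real k *\<^sub>R a m" using k m by (intro scaleR_mono) auto
      also have "\<dots> = (real k * real m) *\<^sub>R s m" by (simp add: a_def)
      \<comment> \<open>The extra \<open>m\<close> keeps the index at least \<open>m\<close> when
        \<open>k = 0\<close>.\<close>
      also have "\<dots> \<le> a (k * m + m)" by (intro a_le) auto
      finally show "c *\<^sub>R x \<in> I" by (auto simp: I_def)
    qed
  qed
  moreover have "Q \<subseteq> I"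
  proof
    fix q assume q: "q \<in> Q"
    then obtain k where k: "q = e k" using range_e by (metis insertI2 imageE)
    have "e k \<le> s (Suc k)"
      using s0[of k] by (simp add: s_def)
    also have "\<dots> \<le> a (Suc k)" using a_le[of 1 "Suc k" "Suc k"] by simp
    finally show "q \<in> I" using k e0[of k] by (auto simp: I_def)
  qed
  ultimately have "order_ideal hull Q \<subseteq> I" by (rule hull_minimal[rotated])
  then show thesis using a0 a_mono by (intro that[of a]) (auto simp: I_def)
qed

section \<open>Solid zero neighbourhoods and density\<close>

lemma zero_nbhd_third:
  fixes \<tau> :: "'a::vector_lattice topology"
  assumes ls: "locally_solid \<tau>" and V: "zero_nbhd \<tau> V"
  obtains V' where "zero_nbhd \<tau> V'" "solid V'"
    "\<And>a b c. a \<in> V' \<Longrightarrow> b \<in> V' \<Longrightarrow> c \<in> V' \<Longrightarrow> a + b + c \<in> V"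
proof -
  obtain V1 where V1: "\<And>a b. a \<in> V1 \<Longrightarrow> b \<in> V1 \<Longrightarrow> a + b \<in> V" "zero_nbhd \<tau> V1"
    using zero_nbhd_half[OF ls V] by metis
  obtain V2 where V2: "\<And>a b. a \<in> V2 \<Longrightarrow> b \<in> V2 \<Longrightarrow> a + b \<in> V1" "zero_nbhd \<tau> V2" "solid V2"
    using zero_nbhd_half[OF ls V1(2)] by metis
  have "c \<in> V1" if "c \<in> V2" for c
    using V2(1)[OF that zero_nbhd_0[OF V2(2)]] by simp
  then show thesis using V1 V2 by (intro that[of V2]) auto
qed

text \<open>Metric balls about \<open>0\<close> give a countable base. Dependent choice picks solid
  sets inside them, each so small that its threefold sums stay in its predecessor.\<close>

lemma countable_solid_base:
  fixes \<tau> :: "'a::vector_lattice topology"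
  assumes ls: "locally_solid \<tau>" and "metrizable_space \<tau>"
  obtains V :: "nat \<Rightarrow> 'a set" where "\<And>n. zero_nbhd \<tau> (V n)" "\<And>n. solid (V n)"
    "\<And>n a b c. a \<in> V (Suc n) \<Longrightarrow> b \<in> V (Suc n) \<Longrightarrow> c \<in> V (Suc n) \<Longrightarrow> a + b + c \<in> V n"
    "\<And>U. zero_nbhd \<tau> U \<Longrightarrow> \<exists>n. V n \<subseteq> U"
proof -
  have top: "topspace \<tau> = UNIV"
    using ls by (simp add: locally_solid_def linear_topology_def)
  obtain M d where "Metric_space M d" and \<tau>: "\<tau> = Metric_space.mtopology M d"
    using assms(2) unfolding metrizable_space_def by blast
  then interpret Metric_space M d by simp
  have zero: "0 \<in> M" using top by (simp add: \<tau>)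
  \<comment> \<open>Only balls centred at \<open>0\<close> occur, as the metric need not be
    translation-invariant.\<close>
  define B where "B n = mball 0 (inverse (real (Suc n)))" for n
  have B: "zero_nbhd \<tau> (B n)" for n
    unfolding zero_nbhd_def by (intro exI[of _ "B n"]) (simp add: B_def \<tau> openin_mball centre_in_mball_iff zero)
  define P where "P n V \<longleftrightarrow> zero_nbhd \<tau> V \<and> solid V \<and> V \<subseteq> B n" for n V
  define R where "R = (\<lambda>(n::nat) V V'. \<forall>a\<in>V'. \<forall>b\<in>V'. \<forall>c\<in>V'. a + b + c \<in> (V::'a set))"
  have step: "\<exists>V'. P n V' \<and> R n V V'" if V: "zero_nbhd \<tau> V" for n V
  proof -
    obtain V' where V': "zero_nbhd \<tau> V'" "solid V'"
      "\<And>a b c. a \<in> V' \<Longrightarrow> b \<in> V' \<Longrightarrow> c \<in> V' \<Longrightarrow> a + b + c \<in> V \<inter> B n"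
      using zero_nbhd_third[OF ls zero_nbhd_Int[OF V B]] by metis
    \<comment> \<open>Padding an element with two zeros turns the threefold-sum property into an
      inclusion.\<close>
    have "V' \<subseteq> B n" using V'(3)[OF _ zero_nbhd_0[OF V'(1)] zero_nbhd_0[OF V'(1)]] by auto
    then show ?thesis using V' by (auto simp: P_def R_def)
  qed
  have "\<exists>V. \<forall>n. P n (V n) \<and> R n (V n) (V (Suc n))"
  proof (rule dependent_nat_choice)
    show "\<exists>V. P 0 V" using step[OF B] by blast
    show "\<exists>V'. P (Suc n) V' \<and> R n V V'" if "P n V" for V n
      using step[of V "Suc n"] that by (auto simp: P_def R_def)
  qed
  then obtain V where V: "\<And>n. P n (V n)" "\<And>n. R n (V n) (V (Suc n))" by blast
  show thesis
  proof (rule that[of V])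
    fix U assume "zero_nbhd \<tau> U"
    then obtain O' where "openin \<tau> O'" "0 \<in> O'" "O' \<subseteq> U" by (auto simp: zero_nbhd_def)
    then obtain r where r: "r > 0" "mball 0 r \<subseteq> U"
      unfolding \<tau> openin_mtopology by blast
    obtain n where "inverse (real (Suc n)) < r" using reals_Archimedean[OF r(1)] by blast
    then have "B n \<subseteq> mball 0 r" unfolding B_def by (intro mball_subset_concentric) simp
    then show "\<exists>n. V n \<subseteq> U" using V(1)[of n] r(2) unfolding P_def by blast
  qed (use V in \<open>auto simp: P_def R_def\<close>)
qed

text \<open>Translation by \<open>- w\<close> is continuous, so the preimage of an open zero
  neighbourhood is an open neighbourhood of \<open>w\<close> and meets \<open>A\<close>.\<close>

lemma closure_of_approx:
  fixes \<tau> :: "'a::vector_lattice topology"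
  assumes ls: "locally_solid \<tau>" and w: "w \<in> \<tau> closure_of A" and V: "zero_nbhd \<tau> V"
  obtains y where "y \<in> A" "y - w \<in> V"
proof -
  obtain U where U: "openin \<tau> U" "0 \<in> U" "U \<subseteq> V" using V by (auto simp: zero_nbhd_def)
  have top: "topspace \<tau> = UNIV" and add: "continuous_map (prod_topology \<tau> \<tau>) \<tau> (\<lambda>(x, y). x + y)"
    using ls by (auto simp: locally_solid_def linear_topology_def)
  have "continuous_map \<tau> (prod_topology \<tau> \<tau>) (\<lambda>y. (y, - w))"
    by (simp add: continuous_map_pairedI top)
  from continuous_map_compose[OF this add] have "continuous_map \<tau> \<tau> (\<lambda>y. y - w)"
    by (simp add: comp_def)
  from openin_continuous_map_preimage[OF this U(1)] have "openin \<tau> {y. y - w \<in> U}"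
    by (simp add: top)
  moreover have "w \<in> {y. y - w \<in> U}" using U(2) by simp
  ultimately have "\<exists>y. y \<in> A \<and> y \<in> {y. y - w \<in> U}"
    using w by (simp only: in_closure_of)
  then obtain y where "y \<in> A" "y - w \<in> U" by (auto simp only: mem_Collect_eq)
  then show thesis using U(3) by (intro that) auto
qed

section \<open>Truncation estimates and separation of points\<close>

text \<open>Replacing the truncation level \<open>w\<close> by a bound \<open>a\<close> of
  \<open>\<bar>y\<bar>\<close> costs at most \<open>\<bar>y - w\<bar>\<close>, because
  \<open>w \<le> a + \<bar>y - w\<bar>\<close> and addition distributes over
  \<open>inf\<close>.\<close>

lemma inf_abs_le_add:
  fixes x w y :: "'a::vector_lattice"
  assumes "\<bar>y\<bar> \<le> a"
  shows "inf \<bar>x\<bar> w \<le> inf \<bar>x\<bar> a + \<bar>y - w\<bar>"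
proof -
  have "w = y + - (y - w)" by simp
  also have "\<dots> \<le> a + \<bar>y - w\<bar>"
    using order_trans[OF abs_ge_self assms] abs_ge_minus_self by (rule add_mono)
  finally have "inf \<bar>x\<bar> w \<le> a + \<bar>y - w\<bar>" by (rule le_infI2)
  moreover have "inf \<bar>x\<bar> w \<le> \<bar>x\<bar> + \<bar>y - w\<bar>"
    by (intro le_infI1) simp
  ultimately show ?thesis by (simp add: add_inf_distrib_right)
qed

text \<open>Truncation at \<open>w\<close> is subadditive on absolute values, and solidity passes
  from the sum of the three truncations to the smaller truncation of the sum.\<close>

lemma unbounded_nbhd_add3:
  fixes V V' :: "'a::vector_lattice set"
  assumes V: "solid V" "\<And>a b c. a \<in> V' \<Longrightarrow> b \<in> V' \<Longrightarrow> c \<in> V' \<Longrightarrow> a + b + c \<in> V" and w: "0 \<le> w"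
    and "x \<in> unbounded_nbhd V' w" "y \<in> unbounded_nbhd V' w" "z \<in> unbounded_nbhd V' w"
  shows "x + y + z \<in> unbounded_nbhd V w"
proof -
  have "inf \<bar>x\<bar> w + inf \<bar>y\<bar> w + inf \<bar>z\<bar> w \<in> V"
    using assms by (simp add: unbounded_nbhd_def)
  moreover have "inf \<bar>x + y + z\<bar> w \<le> inf \<bar>x\<bar> w + inf \<bar>y\<bar> w + inf \<bar>z\<bar> w"
    using order_trans[OF inf_abs_add_le[OF w, of "x + y" z] add_right_mono[OF inf_abs_add_le[OF w, of x y]]] .
  then have "\<bar>inf \<bar>x + y + z\<bar> w\<bar> \<le> \<bar>inf \<bar>x\<bar> w + inf \<bar>y\<bar> w + inf \<bar>z\<bar> w\<bar>"
    using w abs_of_nonneg[of "inf \<bar>x + y + z\<bar> w"]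
      abs_of_nonneg[of "inf \<bar>x\<bar> w + inf \<bar>y\<bar> w + inf \<bar>z\<bar> w"] by simp
  ultimately show ?thesis
    using solidD[OF V(1)] by (simp add: unbounded_nbhd_def)
qed

text \<open>A nonzero \<open>x\<close> is separated from \<open>0\<close> by an open set, which
  contains a solid neighbourhood; by solidity, \<open>\<bar>x\<bar>\<close> in that neighbourhood
  would put \<open>x\<close> there too.\<close>

lemma Hausdorff_zero_nbhd_eq_0:
  assumes "locally_solid \<tau>" "\<And>V. zero_nbhd \<tau> V \<Longrightarrow> solid V \<Longrightarrow> \<bar>x\<bar> \<in> V"
  shows "x = (0::'a::vector_lattice)"
proof (rule ccontr)
  assume "x \<noteq> 0"
  have "Hausdorff_space \<tau>" "topspace \<tau> = UNIV" and base: "neighbourhood_base_at 0 solid \<tau>"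
    using assms(1) by (auto simp: locally_solid_def linear_topology_def)
  with \<open>x \<noteq> 0\<close> obtain U U' where U: "openin \<tau> U" "0 \<in> U" "x \<in> U'" "disjnt U U'"
    unfolding Hausdorff_space_def by (metis UNIV_I)
  then obtain O' V where "openin \<tau> O'" "solid V" "0 \<in> O'" "O' \<subseteq> V" "V \<subseteq> U"
    using base unfolding neighbourhood_base_at_def by meson
  then have "\<bar>x\<bar> \<in> V" "solid V" using assms(2)[of V] by (auto simp: zero_nbhd_def)
  then have "x \<in> V" using solidD[of V "\<bar>x\<bar>" x] by simp
  with \<open>V \<subseteq> U\<close> U show False by (auto simp: disjnt_def)
qed

section \<open>A countable base at zero for the unbounded topology\<close>

theorem proposition5:
  fixes \<tau> :: "'a::vector_lattice topology"
  assumes "locally_solid \<tau>"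
    and "metrizable_space \<tau>"
    and "complete_linear_topology \<tau>"
    and "\<exists>Q. countable Q \<and> topological_orthogonal_system \<tau> Q"
  shows "metrizable_space (unbounded_topology \<tau>)"
proof -
  note ls = assms(1)
  obtain Q where Q: "countable Q" "\<forall>e\<in>Q. 0 \<le> e" and dense: "\<tau> closure_of (order_ideal hull Q) = UNIV"
    using assms(4) ls unfolding topological_orthogonal_system_def orthogonal_system_def
      locally_solid_def linear_topology_def by metis
  obtain a :: "nat \<Rightarrow> 'a" where a: "\<And>n. 0 \<le> a n" "mono a"
    "\<And>y. y \<in> order_ideal hull Q \<Longrightarrow> \<exists>n. \<bar>y\<bar> \<le> a n"
    using order_ideal_hull_cofinal_sequence[OF Q] by blast
  obtain V :: "nat \<Rightarrow> 'a set" where V: "\<And>n. zero_nbhd \<tau> (V n)" "\<And>n. solid (V n)"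
    and V_add: "\<And>n a b c. a \<in> V (Suc n) \<Longrightarrow> b \<in> V (Suc n) \<Longrightarrow> c \<in> V (Suc n) \<Longrightarrow> a + b + c \<in> V n"
    and V_base: "\<And>U. zero_nbhd \<tau> U \<Longrightarrow> \<exists>n. V n \<subseteq> U"
    using countable_solid_base[OF assms(1,2)] by blast
  \<comment> \<open>Level and neighbourhood share one index: \<open>a\<close> increases and
    \<open>V\<close> decreases, so a late enough set meets a demand on both at once.\<close>
  define W where "W n = unbounded_nbhd (V n) (a n)" for n
  have V_Suc: "V (Suc n) \<subseteq> V n" for n
    using V_add[of _ n 0 0] zero_nbhd_0[OF V(1)] by auto
  then have V_anti: "V n \<subseteq> V m" if "m \<le> n" for m n
    using that by (rule lift_Suc_antimono_le)
  have W_base: "\<exists>n. W n \<subseteq> unbounded_nbhd U w" if U: "zero_nbhd \<tau> U" "solid U" and w: "0 \<le> w" for U w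
  proof -
    \<comment> \<open>One summand from \<open>U'\<close> will be the truncation at
      \<open>a m\<close>, the other the approximation error
      \<open>\<bar>y - w\<bar>\<close>.\<close>
    obtain U' where U': "zero_nbhd \<tau> U'" "solid U'" "\<And>a b. a \<in> U' \<Longrightarrow> b \<in> U' \<Longrightarrow> a + b \<in> U"
      using zero_nbhd_half[OF ls U(1)] by metis
    obtain y where y: "y \<in> order_ideal hull Q" "y - w \<in> U'"
      using closure_of_approx[OF ls _ U'(1), of w "order_ideal hull Q"] dense by auto
    obtain m where m: "\<bar>y\<bar> \<le> a m" using a(3)[OF y(1)] ..
    obtain k where k: "V k \<subseteq> U'" using V_base[OF U'(1)] ..
    define n where "n = max m k"
    have "W n \<subseteq> unbounded_nbhd U' (a m)"
      unfolding W_def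
    proof (rule unbounded_nbhd_mono)
      show "a m \<le> a n" using a(2) by (simp add: n_def monoD)
      show "V n \<subseteq> U'" using V_anti[of k n] k by (simp add: n_def)
    qed (use V a in auto)
    moreover have "x \<in> unbounded_nbhd U w" if x: "x \<in> unbounded_nbhd U' (a m)" for x
    proof -
      have "\<bar>y - w\<bar> \<in> U'" using solidD[OF U'(2) y(2)] by simp
      then have "inf \<bar>x\<bar> (a m) + \<bar>y - w\<bar> \<in> U" using x U'(3) by (simp add: unbounded_nbhd_def)
      moreover have "\<bar>inf \<bar>x\<bar> w\<bar> \<le> \<bar>inf \<bar>x\<bar> (a m) + \<bar>y - w\<bar>\<bar>"
        using inf_abs_le_add[OF m, of x w] w a(1)[of m]
          abs_of_nonneg[of "inf \<bar>x\<bar> w"] abs_of_nonneg[of "inf \<bar>x\<bar> (a m) + \<bar>y - w\<bar>"] by simp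
      ultimately show ?thesis
        using solidD[OF U(2)] by (simp add: unbounded_nbhd_def)
    qed
    ultimately show ?thesis by blast
  qed
  show ?thesis
  proof (rule metrizable_space_group_topology[of W])
    show "- x \<in> W n" if "x \<in> W n" for n x
      using that by (simp add: W_def unbounded_nbhd_def)
    show "x + y + z \<in> W n" if "x \<in> W (Suc n)" "y \<in> W (Suc n)" "z \<in> W (Suc n)" for n x y z
    proof -
      \<comment> \<open>Subadditivity needs a common level, so the level is first lowered from
        \<open>a (Suc n)\<close> to \<open>a n\<close>, which only enlarges the set.\<close>
      have "W (Suc n) \<subseteq> unbounded_nbhd (V (Suc n)) (a n)"
        unfolding W_def using a V by (intro unbounded_nbhd_mono) (auto simp: monoD)
      with that show ?thesis
        unfolding W_def[of n] by (intro unbounded_nbhd_add3[OF V(2) V_add a(1)]) auto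
    qed
    show "(\<Inter>n. W n) = {0}"
    proof
      show "{0} \<subseteq> (\<Inter>n. W n)"
        using a(1) zero_nbhd_0[OF V(1)] by (simp add: W_def unbounded_nbhd_def inf.absorb1)
      show "(\<Inter>n. W n) \<subseteq> {0}"
      proof
        fix x assume x: "x \<in> (\<Inter>n. W n)"
        have "\<bar>x\<bar> \<in> U" if U: "zero_nbhd \<tau> U" "solid U" for U
        proof -
          \<comment> \<open>Truncating \<open>\<bar>x\<bar>\<close> at the level
            \<open>\<bar>x\<bar>\<close> changes nothing, so membership here says that
            \<open>\<bar>x\<bar>\<close> itself lies in \<open>U\<close>.\<close>
          have "x \<in> unbounded_nbhd U \<bar>x\<bar>" using W_base[OF U, of "\<bar>x\<bar>"] x by auto
          then show ?thesis by (simp add: unbounded_nbhd_def)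
        qed
        then show "x \<in> {0}" using Hausdorff_zero_nbhd_eq_0[OF ls] by blast
      qed
    qed
    show "openin (unbounded_topology \<tau>) S \<longleftrightarrow> (\<forall>x\<in>S. \<exists>n. (+) x ` W n \<subseteq> S)" for S
    proof -
      have "(\<exists>U w. zero_nbhd \<tau> U \<and> solid U \<and> 0 \<le> w \<and> (+) x ` unbounded_nbhd U w \<subseteq> S) \<longleftrightarrow>
        (\<exists>n. (+) x ` W n \<subseteq> S)" for x
      proof
        assume "\<exists>U w. zero_nbhd \<tau> U \<and> solid U \<and> 0 \<le> w \<and> (+) x ` unbounded_nbhd U w \<subseteq> S"
        then obtain U w n where "(+) x ` unbounded_nbhd U w \<subseteq> S" "W n \<subseteq> unbounded_nbhd U w"
          using W_base by meson
        then show "\<exists>n. (+) x ` W n \<subseteq> S" by blast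
      next
        assume "\<exists>n. (+) x ` W n \<subseteq> S"
        then obtain n where "(+) x ` W n \<subseteq> S" ..
        then show "\<exists>U w. zero_nbhd \<tau> U \<and> solid U \<and> 0 \<le> w \<and> (+) x ` unbounded_nbhd U w \<subseteq> S"
          using V a(1) unfolding W_def by blast
      qed
      then show ?thesis by (simp add: openin_unbounded_topology)
    qed
  qed
qed

end
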